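(* Assume that (B1) and (B2) (stated in the context) are fulfilled. Let $0<\alpha<1$ and denote the permutation test function by $\phi_{K,\mathrm{perm}}=\mathds{1}(p_{\mathrm{perm}}\le\alpha)$. Then under $H_1$, $$\limsup_{n_{\min}\to\infty}\ \sup_{(P_1,\ldots,P_K)\in\mathcal F_h(b_Nr_N^\star)}\mathbb P\big(\phi_{K,\mathrm{perm}}=0\big)=0,$$ where $b_N$ is an arbitrary (positive) sequence that goes to infinity as $n_{\min}\to\infty$, and $r_N^\star=\sqrt{\log K/n_{\min}}$.
   Context: $h:\mathcal X\times\mathcal X\to\mathbb R$ is a fixed reproducing kernel of a reproducing kernel Hilbert space $\mathcal H$ on the measurable space $(\mathcal X,\mathcal B)$ with feature map $\psi:\mathcal X\to\mathcal H$, $h(x,y)=\langle\psi(x),\psi(y)\rangle_{\mathcal H}$. $K\ge2$ is the number of distributions, either fixed or increasing with $n_{\min}$. $X_{1,k},\ldots,X_{n_k,k}\sim P_k$, $k=1,\ldots,K$, all mutually independent; $N=\sum_kn_k$; $n_{\max},n_{\min}$ are the maximum and minimum of $\{n_1,\ldots,n_K\}$; the pooled sample is $\{Z_1,\ldots,Z_N\}=\{X_{1,1},\ldots,X_{n_K,K}\}$, listed sample by sample. The statistic is $\widehat{\mathcal V}_{h,\max}=\max_{1\le k<l\le K}\big\|n_k^{-1}\sum_{i=1}^{n_k}\psi(X_{i,k})-n_l^{-1}\sum_{j=1}^{n_l}\psi(X_{j,l})\big\|_{\mathcal H}$. Let $\mathcal B_N$ be the set of all permutations of $\{1,\ldots,N\}$;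 for $\boldsymbol b\in\mathcal B_N$, $\widehat{\mathcal V}_{h,\max}^{(\boldsymbol b)}$ is the statistic computed from the permuted dataset $(Z_{b_1},\ldots,Z_{b_N})$ (first $n_1$ points as sample 1, next $n_2$ as sample 2, etc.). The permutation $p$-value is $$p_{\mathrm{perm}}=\frac1{N!}\sum_{\boldsymbol b\in\mathcal B_N}\mathds{1}\big(\widehat{\mathcal V}_{h,\max}^{(\boldsymbol b)}\ge\widehat{\mathcal V}_{h,\max}\big).$$ Maximum mean discrepancy: $\mathcal V_h(P,Q)=\|\mathbb E_{X\sim P}[\psi(X)]-\mathbb E_{Y\sim Q}[\psi(Y)]\|_{\mathcal H}$, and $\mathcal V_{kl}=\mathcal V_h(P_k,P_l)$. For $\epsilon>0$, $$\mathcal F_h(\epsilon)=\big\{(P_1,\ldots,P_K):\text{each }P_k\text{ is a probability distribution on }(\mathcal X,\mathcal B),\ \max_{1\le k<l\le K}\mathcal V_{kl}\ge\epsilon\big\}.$$ "Under $H_1$" means the $P_k$ are not all equal (automatic on $\mathcal F_h(\epsilon)$, $\epsilon>0$). The supremum over an empty class is $0$. (B1) There is a constant $B$ with $0\le h(x,y)\le B$ for all $x,y\in\mathcal X$. (B2) There exists a fixed constant $c>0$ such that $n_{\max}/n_{\min}\le c$ for any sample sizes considered. *)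

theory Defs
  imports "HOL-Probability.Probability" "HOL-Combinatorics.Permutations"
begin

text \<open>
  A Hilbert space is a type of class \<^class>\<open>real_inner\<close> and \<^class>\<open>complete_space\<close>. It is a
  space of functions on \<open>X\<close> by means of an evaluation map: \<open>val_at f x\<close> is the value of \<open>f\<close> at \<open>x\<close>,
  and distinct elements are distinct functions on \<open>X\<close>. Linearity of the evaluation map on \<open>X\<close>
  follows from the reproducing property. Separability is not assumed.
\<close>

definition reproducing_kernel ::
  "'a set \<Rightarrow> ('h::{real_inner,complete_space} \<Rightarrow> 'a \<Rightarrow> real) \<Rightarrow> ('a \<Rightarrow> 'a \<Rightarrow> real) \<Rightarrow> bool" where
  "reproducing_kernel X val_at h \<longleftrightarrow>
     inj (\<lambda>f. restrict (val_at f) X) \<and>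
     (\<forall>y\<in>X. \<exists>k. (\<forall>x\<in>X. val_at k x = h x y) \<and> (\<forall>f. val_at f y = inner f k))"

definition feature_map ::
  "'a set \<Rightarrow> ('a \<Rightarrow> 'a \<Rightarrow> real) \<Rightarrow> ('a \<Rightarrow> 'h::{real_inner,complete_space}) \<Rightarrow> bool" where
  "feature_map X h \<psi> \<longleftrightarrow> (\<forall>x\<in>X. \<forall>y\<in>X. h x y = inner (\<psi> x) (\<psi> y))"

text \<open>
  The Hilbert-space expectation of \<open>\<psi>(X)\<close>, \<open>X \<sim> P\<close>, in the weak sense. The library's Bochner
  integral is only available for second-countable spaces; there the two agree, see below.
\<close>

definition kernel_mean ::
  "'a measure \<Rightarrow> ('a \<Rightarrow> 'h::{real_inner,complete_space}) \<Rightarrow> 'h" where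
  "kernel_mean P \<psi> = (THE m. \<forall>f. has_bochner_integral P (\<lambda>x. inner (\<psi> x) f) (inner m f))"

lemma kernel_mean_eq_integral:
  fixes \<psi> :: "'a \<Rightarrow> 'h::{real_inner,banach,second_countable_topology}"
  assumes "integrable P \<psi>"
  shows "kernel_mean P \<psi> = integral\<^sup>L P \<psi>"
  unfolding kernel_mean_def
proof (rule the_equality)
  show weak: "\<forall>f. has_bochner_integral P (\<lambda>x. inner (\<psi> x) f) (inner (integral\<^sup>L P \<psi>) f)"
    using has_bochner_integral_integrable[OF assms] by (auto intro: has_bochner_integral_inner_left)
  fix m assume "\<forall>f. has_bochner_integral P (\<lambda>x. inner (\<psi> x) f) (inner m f)"
  with weak have "inner m f = inner (integral\<^sup>L P \<psi>) f" for f
    by (meson has_bochner_integral_eq)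
  then show "m = integral\<^sup>L P \<psi>"
    by (metis vector_eq_rdot)
qed

definition mmd ::
  "('a \<Rightarrow> 'h::{real_inner,complete_space}) \<Rightarrow> 'a measure \<Rightarrow> 'a measure \<Rightarrow> real" where
  "mmd \<psi> P Q = norm (kernel_mean P \<psi> - kernel_mean Q \<psi>)"

definition index_pairs :: "nat \<Rightarrow> (nat \<times> nat) set" where
  "index_pairs K = {(k, l). 1 \<le> k \<and> k < l \<and> l \<le> K}"

text \<open>Only the values \<open>P k\<close> for \<open>1 \<le> k \<le> K\<close> are relevant.\<close>

definition alternatives ::
  "'a measure \<Rightarrow> ('a \<Rightarrow> 'h::{real_inner,complete_space}) \<Rightarrow> nat \<Rightarrow> real \<Rightarrow> (nat \<Rightarrow> 'a measure) set" where
  "alternatives M \<psi> K \<epsilon> =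
     {P. (\<forall>k\<in>{1..K}. prob_space (P k) \<and> sets (P k) = sets M) \<and>
         (MAX (k, l)\<in>index_pairs K. mmd \<psi> (P k) (P l)) \<ge> \<epsilon>}"

definition n_min :: "nat \<Rightarrow> (nat \<Rightarrow> nat) \<Rightarrow> nat" where
  "n_min K n = Min (n ` {1..K})"

definition n_max :: "nat \<Rightarrow> (nat \<Rightarrow> nat) \<Rightarrow> nat" where
  "n_max K n = Max (n ` {1..K})"

definition total_size :: "nat \<Rightarrow> (nat \<Rightarrow> nat) \<Rightarrow> nat" where
  "total_size K n = (\<Sum>k=1..K. n k)"

text \<open>
  The samples are a function \<open>x\<close> of pairs: \<open>x (k, i)\<close> is the \<open>i\<close>-th observation of sample \<open>k\<close>.
  They are taken on the canonical space, so that all \<open>x (k, i)\<close> are independent with law \<open>P k\<close>.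
\<close>

definition sample_law :: "nat \<Rightarrow> (nat \<Rightarrow> nat) \<Rightarrow> (nat \<Rightarrow> 'a measure) \<Rightarrow> (nat \<times> nat \<Rightarrow> 'a) measure" where
  "sample_law K n P = Pi\<^sub>M (SIGMA k:{1..K}. {1..n k}) (\<lambda>(k, i). P k)"

definition statistic ::
  "('a \<Rightarrow> 'h::{real_inner,complete_space}) \<Rightarrow> nat \<Rightarrow> (nat \<Rightarrow> nat) \<Rightarrow> (nat \<times> nat \<Rightarrow> 'a) \<Rightarrow> real" where
  "statistic \<psi> K n x =
     (MAX (k, l)\<in>index_pairs K.
        norm ((1 / real (n k)) *\<^sub>R (\<Sum>i=1..n k. \<psi> (x (k, i)))
            - (1 / real (n l)) *\<^sub>R (\<Sum>j=1..n l. \<psi> (x (l, j)))))"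

text \<open>
  Pooling lists the samples one after the other: \<open>x (k, i)\<close> becomes
  observation number \<open>offset n k + i\<close>, and \<open>sample_of n m\<close> is the sample containing number \<open>m\<close>.
\<close>

definition offset :: "(nat \<Rightarrow> nat) \<Rightarrow> nat \<Rightarrow> nat" where
  "offset n k = (\<Sum>j\<in>{1..<k}. n j)"

definition sample_of :: "(nat \<Rightarrow> nat) \<Rightarrow> nat \<Rightarrow> nat" where
  "sample_of n m = (LEAST k. m \<le> (\<Sum>j=1..k. n j))"

definition pool :: "(nat \<Rightarrow> nat) \<Rightarrow> (nat \<times> nat \<Rightarrow> 'a) \<Rightarrow> nat \<Rightarrow> 'a" where
  "pool n x m = x (sample_of n m, m - offset n (sample_of n m))"

definition split_samples :: "(nat \<Rightarrow> nat) \<Rightarrow> (nat \<Rightarrow> 'a) \<Rightarrow> nat \<times> nat \<Rightarrow> 'a" where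
  "split_samples n z = (\<lambda>(k, i). z (offset n k + i))"

lemma pool_offset:
  assumes "1 \<le> k" "1 \<le> i" "i \<le> n k"
  shows "pool n x (offset n k + i) = x (k, i)"
proof -
  have "(\<Sum>j=1..k. n j) = offset n k + n k"
    using assms(1) by (cases k) (simp_all add: offset_def atLeastLessThanSuc_atLeastAtMost)
  moreover have "k \<le> l" if "offset n k + i \<le> (\<Sum>j=1..l. n j)" for l
  proof (rule ccontr)
    assume "\<not> k \<le> l"
    then have "(\<Sum>j=1..l. n j) \<le> offset n k"
      unfolding offset_def by (intro sum_mono2) auto
    with that assms(2) show False by simp
  qed
  ultimately have "sample_of n (offset n k + i) = k"
    unfolding sample_of_def using assms(3) by (intro Least_equality) auto
  then show ?thesis by (simp add: pool_def)
qed

definition permuted_statistic ::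
  "('a \<Rightarrow> 'h::{real_inner,complete_space}) \<Rightarrow> nat \<Rightarrow> (nat \<Rightarrow> nat) \<Rightarrow> (nat \<times> nat \<Rightarrow> 'a) \<Rightarrow>
    (nat \<Rightarrow> nat) \<Rightarrow> real" where
  "permuted_statistic \<psi> K n x b = statistic \<psi> K n (split_samples n (\<lambda>m. pool n x (b m)))"

definition p_perm ::
  "('a \<Rightarrow> 'h::{real_inner,complete_space}) \<Rightarrow> nat \<Rightarrow> (nat \<Rightarrow> nat) \<Rightarrow> (nat \<times> nat \<Rightarrow> 'a) \<Rightarrow> real" where
  "p_perm \<psi> K n x =
     (1 / fact (total_size K n)) *
     (\<Sum>b | b permutes {1..total_size K n}.
        of_bool (permuted_statistic \<psi> K n x b \<ge> statistic \<psi> K n x))"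

definition perm_test ::
  "('a \<Rightarrow> 'h::{real_inner,complete_space}) \<Rightarrow> nat \<Rightarrow> (nat \<Rightarrow> nat) \<Rightarrow> real \<Rightarrow> (nat \<times> nat \<Rightarrow> 'a) \<Rightarrow> nat" where
  "perm_test \<psi> K n \<alpha> x = of_bool (p_perm \<psi> K n x \<le> \<alpha>)"

definition r_star :: "nat \<Rightarrow> (nat \<Rightarrow> nat) \<Rightarrow> real" where
  "r_star K n = sqrt (ln (real K) / real (n_min K n))"

text \<open>
  The supremum is taken in \<^typ>\<open>ennreal\<close>, where it is \<open>0\<close> over an empty class.
\<close>

definition worst_type_II_error ::
  "'a measure \<Rightarrow> ('a \<Rightarrow> 'h::{real_inner,complete_space}) \<Rightarrow> nat \<Rightarrow> (nat \<Rightarrow> nat) \<Rightarrow> real \<Rightarrow> real \<Rightarrow> ennreal" where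
  "worst_type_II_error M \<psi> K n \<alpha> \<epsilon> =
     (SUP P\<in>alternatives M \<psi> K \<epsilon>.
        emeasure (sample_law K n P) {x \<in> space (sample_law K n P). perm_test \<psi> K n \<alpha> x = 0})"

end

theory Submission
  imports Defs
begin

text \<open>
  Write \<open>R\<^sup>2\<close> for a bound on the kernel, \<open>n\<close> for the smallest sample size and \<open>\<epsilon> = b r\<close> for the separation,
  where \<open>r = \<surd>(ln K / n)\<close>. The test fails to reject only if the p-value exceeds \<open>\<alpha>\<close>, and this is excluded
  in two steps.

  The observed statistic is large. Let \<open>k, l\<close> be samples whose laws have discrepancy at least \<open>\<epsilon>\<close>. By
  Chebyshev's inequality in the Hilbert space (\<open>empirical_mean_deviation\<close>), both empirical means are within
  \<open>\<epsilon> / 4\<close> of the kernel means outside an event of probability at most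
  \<open>128 R\<^sup>2 / (n \<epsilon>\<^sup>2) \<le> 128 R\<^sup>2 / (b\<^sup>2 ln 2)\<close>, which tends to zero. On the complement the statistic is at least
  \<open>\<epsilon> / 2\<close>.

  The permuted statistics are small, whatever the data are. If a permuted statistic is at least \<open>\<epsilon> / 2\<close>,
  then one of the \<open>K\<close> permuted sample means is at distance at least \<open>\<epsilon> / 4\<close> from the pooled mean. Each of
  them is the mean of a sample drawn without replacement from a bounded population, and is sub-Gaussian with
  a variance proxy of order \<open>R\<^sup>2 / n\<close> (\<open>block_mean_tail\<close>), by McDiarmid's martingale argument for random
  permutations (\<open>permutation_mgf\<close>). Hence the fraction of such permutations is at most
  \<open>K exp (- n \<epsilon>\<^sup>2 / (512 R\<^sup>2)) = K powr (1 - b\<^sup>2 / (512 R\<^sup>2))\<close> (\<open>p_perm_le\<close>), which is eventually at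
  most \<open>\<alpha>\<close>, uniformly in \<open>K \<ge> 2\<close>. The factor \<open>ln K\<close> in the separation rate pays for this union bound.

  Kernel means are weak integrals in a possibly non-separable space; they exist by the Riesz representation
  theorem (\<open>has_kernel_mean\<close>).
\<close>

section \<open>Weak means in a Hilbert space\<close>

text \<open>
  The Riesz representation theorem on a closed subspace. The representer is the minimiser of
  \<open>J v = \<parallel>v\<parallel>\<^sup>2 - 2 L v\<close>; by the parallelogram law every minimising sequence is Cauchy, which only
  needs completeness. With \<open>L = \<langle>f, \<cdot>\<rangle>\<close> the representer is the orthogonal projection of \<open>f\<close>.
\<close>

lemma riesz_closed_subspace:
  fixes L :: "'h::{real_inner,complete_space} \<Rightarrow> real"
  assumes V: "subspace V" "closed V" and L: "bounded_linear L"
  obtains m where "m \<in> V" "\<And>v. v \<in> V \<Longrightarrow> inner m v = L v"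
proof -
  interpret L: bounded_linear L by (fact L)
  define J where "J v = (norm v)\<^sup>2 - 2 * L v" for v
  define I where "I = (INF v\<in>V. J v)"
  obtain C where C: "\<And>v. \<bar>L v\<bar> \<le> norm v * C"
    using L.bounded by auto
  have J_lower: "J v \<ge> - C\<^sup>2" for v
  proof -
    have "L v \<le> norm v * C" using C[of v] by linarith
    moreover have "0 \<le> (norm v - C)\<^sup>2" by simp
    ultimately show ?thesis unfolding J_def by (simp add: power2_diff algebra_simps)
  qed
  have bdd: "bdd_below (J ` V)" using J_lower by (intro bdd_belowI2)
  have I_le: "I \<le> J v" if "v \<in> V" for v
    unfolding I_def using bdd that by (rule cINF_lower)
  have "\<exists>v\<in>V. J v < I + 1 / real (Suc k)" for k
    unfolding I_def using cINF_less_iff[OF _ bdd] subspace_0[OF V(1)]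
    by (metis I_def emptyE less_add_same_cancel1 of_nat_0_less_iff zero_less_Suc zero_less_divide_1_iff)
  then obtain w where w: "\<And>k. w k \<in> V" "\<And>k. J (w k) < I + 1 / real (Suc k)" by metis
  have close: "(dist (w i) (w j))\<^sup>2 \<le> 2 / real (Suc i) + 2 / real (Suc j)" for i j
  proof -
    have "(1/2) *\<^sub>R (w i + w j) \<in> V"
      using V(1) w(1) by (intro subspace_scale subspace_add)
    then have "I \<le> J ((1/2) *\<^sub>R (w i + w j))" by (rule I_le)
    moreover have "(dist (w i) (w j))\<^sup>2 =
        2 * J (w i) + 2 * J (w j) - 4 * J ((1/2) *\<^sub>R (w i + w j))"
      unfolding J_def dist_norm L.scaleR L.add
      by (simp add: power2_norm_eq_inner inner_add_left inner_add_right inner_diff_left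
          inner_diff_right inner_commute[of "w j" "w i"] algebra_simps)
    moreover have "2 / real (Suc k) = 2 * (1 / real (Suc k))" for k by simp
    ultimately show ?thesis using w(2)[of i] w(2)[of j] by linarith
  qed
  have "Cauchy w"
  proof (rule metric_CauchyI)
    fix e :: real assume e: "0 < e"
    obtain N where N: "4 / e\<^sup>2 < real N" using reals_Archimedean2 by blast
    show "\<exists>N. \<forall>i\<ge>N. \<forall>j\<ge>N. dist (w i) (w j) < e"
    proof (intro exI allI impI)
      fix i j assume ij: "N \<le> i" "N \<le> j"
      have Npos: "0 < real N" using N e by (meson divide_nonneg_nonneg le_less_trans zero_le_numeral zero_le_power2)
      have *: "2 / real (Suc i) \<le> 2 / real N" "2 / real (Suc j) \<le> 2 / real N"
        using ij Npos by (intro divide_left_mono; simp)+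
      have "4 / real N < e\<^sup>2" using N e Npos by (simp add: field_simps)
      then have "(dist (w i) (w j))\<^sup>2 < e\<^sup>2" using close[of i j] * by linarith
      then show "dist (w i) (w j) < e" using e by (meson less_imp_le power2_less_imp_less)
    qed
  qed
  then obtain m where lim: "w \<longlonglongrightarrow> m" using Cauchy_convergent convergent_def by blast
  have mV: "m \<in> V" using V(2) w(1) lim by (meson closed_sequentially)
  have "(\<lambda>k. J (w k)) \<longlonglongrightarrow> J m"
    unfolding J_def using lim by (intro tendsto_intros L.tendsto)
  moreover have "(\<lambda>k. I + 1 / real (Suc k)) \<longlonglongrightarrow> I + 0"
    by (intro tendsto_intros LIMSEQ_Suc[OF lim_1_over_n])
  ultimately have Jm: "J m \<le> I" 
    using w(2) by (intro LIMSEQ_le) (auto intro: less_imp_le)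
  have "inner m v = L v" if v: "v \<in> V" for v
  proof (rule ccontr)
    assume ne: "inner m v \<noteq> L v"
    define d where "d = inner m v - L v"
    have poly: "0 \<le> t\<^sup>2 * (norm v)\<^sup>2 + 2 * t * d" for t
    proof -
      have "m + t *\<^sub>R v \<in> V" using mV v V(1) by (intro subspace_add subspace_scale)
      then have "J m \<le> J (m + t *\<^sub>R v)" using Jm I_le by fastforce
      moreover have "J (m + t *\<^sub>R v) = J m + t\<^sup>2 * (norm v)\<^sup>2 + 2 * t * d"
        unfolding J_def d_def L.scaleR L.add power2_norm_eq_inner power2_eq_square[of t]
        by (simp add: inner_add_left inner_add_right inner_commute[of v m] algebra_simps)
      ultimately show ?thesis by linarith
    qed
    have "v \<noteq> 0" using ne L.zero by auto
    then have nv: "(norm v)\<^sup>2 > 0" by simp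
    \<comment> \<open>evaluate \<open>poly\<close> at its minimiser \<open>t = - d / \<parallel>v\<parallel>\<^sup>2\<close>\<close>
    have "0 \<le> (- d / (norm v)\<^sup>2)\<^sup>2 * (norm v)\<^sup>2 + 2 * (- d / (norm v)\<^sup>2) * d" by (rule poly)
    also have "\<dots> = - d\<^sup>2 / (norm v)\<^sup>2"
      using nv by (simp add: field_simps power2_eq_square)
    finally have "d\<^sup>2 \<le> 0" using nv by (simp add: field_simps)
    with ne show False by (simp add: d_def)
  qed
  with mV show ?thesis by (rule that)
qed

text \<open>
  Measurability of the kernel makes \<open>\<langle>\<psi>(x), f\<rangle>\<close> measurable in \<open>x\<close> for every \<open>f\<close>, even when the Hilbert
  space is not separable. The set \<open>W\<close> of all good \<open>f\<close> is a closed subspace that contains every feature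
  vector, so the component of \<open>f\<close> orthogonal to \<open>W\<close> does not contribute to the inner product.
\<close>

lemma feature_map_weakly_measurable:
  fixes \<psi> :: "'a \<Rightarrow> 'h::{real_inner,complete_space}"
  assumes feature: "feature_map (space M) h \<psi>"
    and h[measurable]: "(\<lambda>(x, y). h x y) \<in> borel_measurable (M \<Otimes>\<^sub>M M)"
  shows "(\<lambda>x. inner (\<psi> x) f) \<in> borel_measurable M"
proof -
  define W where "W = {f. (\<lambda>x. inner (\<psi> x) f) \<in> borel_measurable M}"
  have sub: "subspace W"
    unfolding W_def by (rule subspaceI) (auto simp: inner_add_right)
  have clo: "closed W"
    unfolding closed_sequential_limits
  proof (intro allI impI, elim conjE)
    fix g l assume g: "\<forall>n. g n \<in> W" and l: "g \<longlonglongrightarrow> l"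
    have "(\<lambda>x. inner (\<psi> x) l) \<in> borel_measurable M"
    proof (rule borel_measurable_LIMSEQ_real)
      show "(\<lambda>x. inner (\<psi> x) (g n)) \<in> borel_measurable M" for n
        using g by (auto simp: W_def)
      show "(\<lambda>n. inner (\<psi> x) (g n)) \<longlonglongrightarrow> inner (\<psi> x) l" for x
        using l by (intro tendsto_intros)
    qed
    then show "l \<in> W" by (simp add: W_def)
  qed
  have feat: "\<psi> y \<in> W" if y: "y \<in> space M" for y
  proof -
    have "(\<lambda>x. case (x, y) of (x, y) \<Rightarrow> h x y) \<in> borel_measurable M"
      using y by (intro measurable_compose[OF _ h]) simp
    moreover have "(\<lambda>x. inner (\<psi> x) (\<psi> y)) \<in> borel_measurable M \<longleftrightarrow>
        (\<lambda>x. case (x, y) of (x, y) \<Rightarrow> h x y) \<in> borel_measurable M"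
      using feature y by (intro measurable_cong) (auto simp: feature_map_def)
    ultimately show ?thesis by (simp add: W_def)
  qed
  obtain p where p: "p \<in> W" "\<And>v. v \<in> W \<Longrightarrow> inner p v = inner f v"
    using riesz_closed_subspace[OF sub clo bounded_linear_inner_right[of f]] by metis
  have "(\<lambda>x. inner (\<psi> x) f) \<in> borel_measurable M \<longleftrightarrow> (\<lambda>x. inner (\<psi> x) p) \<in> borel_measurable M"
    using p(2)[OF feat] by (intro measurable_cong) (simp add: inner_commute)
  with p(1) show ?thesis by (simp add: W_def)
qed

text \<open>
  For a bounded, weakly measurable feature map the weak mean exists, so that the definite description
  in \<^const>\<open>kernel_mean\<close> denotes it.
\<close>

lemma has_kernel_mean:
  fixes \<psi> :: "'a \<Rightarrow> 'h::{real_inner,complete_space}"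
  assumes "prob_space P"
    and meas: "\<And>f. (\<lambda>x. inner (\<psi> x) f) \<in> borel_measurable P"
    and bound: "\<And>x. x \<in> space P \<Longrightarrow> norm (\<psi> x) \<le> R"
  shows "has_bochner_integral P (\<lambda>x. inner (\<psi> x) f) (inner (kernel_mean P \<psi>) f)"
proof -
  interpret prob_space P by fact
  have pointwise: "norm (inner (\<psi> x) f) \<le> norm f * R" if "x \<in> space P" for x f
    using Cauchy_Schwarz_ineq2[of "\<psi> x" f] mult_right_mono[OF bound[OF that] norm_ge_zero[of f]]
    by (simp add: mult.commute)
  have int: "integrable P (\<lambda>x. inner (\<psi> x) f)" for f
    using pointwise meas by (intro integrable_const_bound[where B = "norm f * R"]) auto
  have "bounded_linear (\<lambda>f. \<integral>x. inner (\<psi> x) f \<partial>P)"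
  proof (rule bounded_linear_intro[where K = R])
    fix f
    have "norm (\<integral>x. inner (\<psi> x) f \<partial>P) \<le> (\<integral>x. norm (inner (\<psi> x) f) \<partial>P)"
      by (rule integral_norm_bound)
    also have "\<dots> \<le> (\<integral>x. norm f * R \<partial>P)"
      using pointwise int by (intro integral_mono) auto
    finally show "norm (\<integral>x. inner (\<psi> x) f \<partial>P) \<le> norm f * R" by (simp add: prob_space)
  qed (use int in \<open>auto simp: inner_add_right\<close>)
  then obtain m where "\<And>f. inner m f = (\<integral>x. inner (\<psi> x) f \<partial>P)"
    using riesz_closed_subspace[of UNIV] by auto
  then have m: "\<forall>f. has_bochner_integral P (\<lambda>x. inner (\<psi> x) f) (inner m f)"
    using int by (auto simp: has_bochner_integral_iff)
  have "kernel_mean P \<psi> = m"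
    unfolding kernel_mean_def
  proof (rule the_equality)
    show "\<forall>f. has_bochner_integral P (\<lambda>x. inner (\<psi> x) f) (inner m f)" by (fact m)
    fix m' assume "\<forall>f. has_bochner_integral P (\<lambda>x. inner (\<psi> x) f) (inner m' f)"
    with m have "inner m' f = inner m f" for f
      by (meson has_bochner_integral_eq)
    then show "m' = m" by (metis vector_eq_rdot)
  qed
  with m show ?thesis by simp
qed

section \<open>Concentration for random permutations\<close>

text \<open>
  The expectation of \<open>F p\<close> for a uniformly random permutation \<open>p\<close> of \<open>S\<close>. For finite \<open>S\<close> the
  denominator is the number of permutations.
\<close>

definition perm_avg :: "'b set \<Rightarrow> (('b \<Rightarrow> 'b) \<Rightarrow> real) \<Rightarrow> real" where
  "perm_avg S F = (\<Sum>p | p permutes S. F p) / fact (card S)"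

lemma perm_avg_mono:
  assumes "\<And>p. p permutes S \<Longrightarrow> F p \<le> G p"
  shows "perm_avg S F \<le> perm_avg S G"
  unfolding perm_avg_def using assms by (intro divide_right_mono sum_mono) auto

lemma perm_avg_cong:
  assumes "\<And>p. p permutes S \<Longrightarrow> F p = G p"
  shows "perm_avg S F = perm_avg S G"
  unfolding perm_avg_def using assms by (intro arg_cong2[where f = "(/)"] sum.cong) auto

lemma perm_avg_const [simp]: "finite S \<Longrightarrow> perm_avg S (\<lambda>_. c) = c"
  by (simp add: perm_avg_def card_permutations)

lemma perm_avg_sum: "perm_avg S (\<lambda>p. \<Sum>i\<in>I. F i p) = (\<Sum>i\<in>I. perm_avg S (F i))"
  unfolding perm_avg_def by (subst sum.swap) (simp add: sum_divide_distrib)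

lemma perm_avg_cmult: "perm_avg S (\<lambda>p. c * F p) = c * perm_avg S F"
  unfolding perm_avg_def by (simp add: sum_distrib_left)

lemma perm_avg_diff: "perm_avg S (\<lambda>p. F p - G p) = perm_avg S F - perm_avg S G"
  unfolding perm_avg_def by (simp add: sum_subtractf diff_divide_distrib)

lemma perm_avg_compose_left:
  assumes "q permutes S"
  shows "perm_avg S (\<lambda>p. F (q \<circ> p)) = perm_avg S F"
proof -
  have img: "(\<circ>) q ` {p. p permutes S} = {p. p permutes S}"
    using image_compose_permutations_left[OF assms] by (simp only: image_Collect)
  have "inj_on ((\<circ>) q) {p. p permutes S}"
    using permutes_inj[OF assms] by (auto intro!: inj_onI simp: fun_eq_iff inj_eq)
  from sum.reindex[OF this, of F] show ?thesis
    unfolding perm_avg_def img by (simp add: o_def)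
qed

lemma perm_avg_compose_right:
  assumes "q permutes S"
  shows "perm_avg S (\<lambda>p. F (p \<circ> q)) = perm_avg S F"
proof -
  have img: "(\<lambda>p. p \<circ> q) ` {p. p permutes S} = {p. p permutes S}"
    using image_compose_permutations_right[OF assms] by (simp only: image_Collect)
  have "inj_on (\<lambda>p. p \<circ> q) {p. p permutes S}"
    using permutes_surj[OF assms] by (auto intro!: inj_onI simp: fun_eq_iff surj_def) metis
  from sum.reindex[OF this, of F] show ?thesis
    unfolding perm_avg_def img by (simp add: o_def)
qed

text \<open>
  Exposing the image of one point: \<open>c\<close> is the image of \<open>a\<close>, and the rest of the permutation is a
  uniformly random permutation of the remaining points, relabelled by the transposition of \<open>a\<close> and \<open>c\<close>.
\<close>

lemma perm_avg_insert:
  assumes "finite S" "a \<notin> S"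
  shows "perm_avg (insert a S) F =
    (\<Sum>c\<in>insert a S. perm_avg S (\<lambda>q. F (Transposition.transpose a c \<circ> q))) / real (card (insert a S))"
  unfolding perm_avg_def sum_over_permutations_insert[OF assms] using assms
  by (simp del: sum.insert add: sum_divide_distrib[symmetric] mult.commute)

text \<open>
  Hoeffding's lemma for the uniform distribution on a finite set, with the range of the random variable
  given by its oscillation \<open>d\<close>.
\<close>

lemma hoeffding_finite_average:
  fixes G :: "'b \<Rightarrow> real" and d l :: real
  assumes C: "finite C" "C \<noteq> {}" and osc: "\<And>c c'. c \<in> C \<Longrightarrow> c' \<in> C \<Longrightarrow> \<bar>G c - G c'\<bar> \<le> d"
    and l: "l > 0"
  shows "(\<Sum>c\<in>C. exp (l * G c)) / card C \<le> exp (l * ((\<Sum>c\<in>C. G c) / card C) + l\<^sup>2 * d\<^sup>2 / 8)"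
proof -
  define p where "p = pmf_of_set C"
  define \<mu> where "\<mu> = (\<Sum>c\<in>C. G c) / card C"
  obtain c0 where c0: "c0 \<in> C" "\<And>c. c \<in> C \<Longrightarrow> G c0 \<le> G c"
    using C by (metis arg_min_if_finite(1,2) not_le)
  have bounds: "G c \<in> {G c0..G c0 + d}" if "c \<in> C" for c
    using c0 osc[OF that c0(1)] that by auto
  interpret interval_bounded_random_variable "measure_pmf p" G "G c0" "G c0 + d"
    using C bounds by unfold_locales (auto simp: AE_measure_pmf_iff p_def)
  have mean: "integral\<^sup>L (measure_pmf p) G = \<mu>"
    unfolding p_def \<mu>_def by (rule integral_pmf_of_set[OF C(2,1)])
  have "ennreal (\<Sum>c\<in>C. exp (l * (G c - \<mu>)) / card C) = nn_integral (measure_pmf p) (\<lambda>x. exp (l * (G x - \<mu>)))"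
    using C by (simp add: p_def nn_integral_pmf_of_set sum_divide_distrib[symmetric] divide_ennreal
        card_gt_0_iff sum_nonneg ennreal_of_nat_eq_real_of_nat)
  also have "\<dots> \<le> ennreal (exp (l\<^sup>2 * (G c0 + d - G c0)\<^sup>2 / 8))"
    using Hoeffdings_lemma_nn_integral[OF l] mean by auto
  finally have "(\<Sum>c\<in>C. exp (l * (G c - \<mu>)) / card C) \<le> exp (l\<^sup>2 * d\<^sup>2 / 8)"
    by simp
  then have "exp (l * \<mu>) * (\<Sum>c\<in>C. exp (l * (G c - \<mu>)) / card C) \<le> exp (l * \<mu>) * exp (l\<^sup>2 * d\<^sup>2 / 8)"
    by (intro mult_left_mono) auto
  then show ?thesis
    unfolding \<mu>_def[symmetric]
    by (simp add: sum_distrib_left exp_add[symmetric] algebra_simps sum_divide_distrib)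
qed

text \<open>
  McDiarmid's argument for random permutations. If \<open>F p\<close> depends only on the values of \<open>p\<close> on \<open>J\<close>, and
  swapping two values of \<open>p\<close> changes \<open>F p\<close> by at most \<open>d\<close>, then exposing the values on \<open>J\<close> one after
  the other gives a martingale with \<open>card J\<close> steps, each of conditional range at most \<open>d\<close>. The number of
  steps is the size of \<open>J\<close> and not that of \<open>S\<close>.
\<close>

lemma permutation_mgf:
  fixes F :: "('b \<Rightarrow> 'b) \<Rightarrow> real" and d l :: real
  assumes "finite S" "J \<subseteq> S"
    and "\<And>p q. p permutes S \<Longrightarrow> q permutes S \<Longrightarrow> (\<And>i. i \<in> J \<Longrightarrow> p i = q i) \<Longrightarrow> F p = F q"
    and "\<And>p u v. p permutes S \<Longrightarrow> u \<in> S \<Longrightarrow> v \<in> S \<Longrightarrow> \<bar>F (Transposition.transpose u v \<circ> p) - F p\<bar> \<le> d"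
    and l: "l > 0"
  shows "perm_avg S (\<lambda>p. exp (l * F p)) \<le> exp (l * perm_avg S F + card J * (l\<^sup>2 * d\<^sup>2 / 8))"
proof -
  have "finite J" using assms(1,2) finite_subset by blast
  then show ?thesis using assms(1-4)
  proof (induction J arbitrary: S F rule: finite_induct)
    case empty
    have "F p = F id" if "p permutes S" for p
      using empty(3)[OF that permutes_id] by blast
    then have "perm_avg S F = perm_avg S (\<lambda>_. F id)"
      "perm_avg S (\<lambda>p. exp (l * F p)) = perm_avg S (\<lambda>_. exp (l * F id))"
      by (intro perm_avg_cong arg_cong[where f = exp] arg_cong[where f = "(*) l"]; blast)+
    then show ?case using empty(1) by simp
  next
    case (insert a J)
    define S' where "S' = S - {a}"
    have S: "S = insert a S'" "a \<notin> S'" "finite S'" "J \<subseteq> S'"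
      using insert.prems(1,2) insert.hyps by (auto simp: S'_def)
    define Fc where "Fc c q = F (Transposition.transpose a c \<circ> q)" for c q
    have perm: "Transposition.transpose a c \<circ> q permutes S" if "c \<in> S" "q permutes S'" for c q
      using that S by (meson insertI1 permutes_compose permutes_subset permutes_swap_id subset_insertI)
    have perm': "q permutes S" if "q permutes S'" for q
      using that S by (meson permutes_subset subset_insertI)
    have Fc_dep: "Fc c p = Fc c q"
      if "c \<in> S" "p permutes S'" "q permutes S'" "\<And>i. i \<in> J \<Longrightarrow> p i = q i" for c p q
      unfolding Fc_def
    proof (rule insert.prems(3))
      fix i assume "i \<in> insert a J"
      then show "(Transposition.transpose a c \<circ> p) i = (Transposition.transpose a c \<circ> q) i"
        using that(4) permutes_not_in[OF that(2) S(2)] permutes_not_in[OF that(3) S(2)] by auto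
    qed (fact perm[OF that(1,2)] perm[OF that(1,3)])+
    have Fc_lip: "\<bar>Fc c (Transposition.transpose u v \<circ> q) - Fc c q\<bar> \<le> d"
      if "c \<in> S" "q permutes S'" "u \<in> S'" "v \<in> S'" for c u v q
    proof -
      define t where "t = Transposition.transpose a c"
      have "t \<circ> Transposition.transpose u v = Transposition.transpose (t u) (t v) \<circ> t"
        unfolding t_def by (auto simp: fun_eq_iff Transposition.transpose_def)
      then have "t \<circ> (Transposition.transpose u v \<circ> q) = Transposition.transpose (t u) (t v) \<circ> (t \<circ> q)"
        by (metis comp_assoc)
      moreover have "t u \<in> S" "t v \<in> S"
        using that S by (auto simp: t_def Transposition.transpose_def)
      ultimately show ?thesis
        unfolding Fc_def using insert.prems(4)[OF perm[OF that(1,2)]] by (metis t_def)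
    qed
    \<comment> \<open>the conditional expectation of \<open>F p\<close> given \<open>p a = c\<close>\<close>
    define G where "G c = perm_avg S' (Fc c)" for c
    have osc': "\<bar>G c - G c'\<bar> \<le> d" if c: "c \<in> S'" "c' \<in> S" for c c'
    proof -
      \<comment> \<open>coupling: composing with \<open>q'\<close> preserves the uniform distribution on the permutations of \<open>S'\<close>,
        and turns the conditioning on \<open>c\<close> into that on \<open>c'\<close> up to one swap\<close>
      have *: "\<exists>q'. q' permutes S' \<and> (\<forall>q. q permutes S' \<longrightarrow> \<bar>Fc c (q' \<circ> q) - Fc c' q\<bar> \<le> d)"
      proof (cases "c' = a")
        case True
        have "\<bar>Fc c (id \<circ> q) - Fc c' q\<bar> \<le> d" if q: "q permutes S'" for q
          unfolding Fc_def True transpose_same id_comp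
          using insert.prems(4)[OF perm'[OF q]] c S by (metis insertI1 insertI2 id_comp)
        then show ?thesis using permutes_id by blast
      next
        case False
        then have c': "c' \<in> S'" using c S by auto
        have "\<bar>Fc c (Transposition.transpose c c' \<circ> q) - Fc c' q\<bar> \<le> d" if q: "q permutes S'" for q
        proof -
          have "Transposition.transpose a c \<circ> Transposition.transpose c c' = Transposition.transpose c c' \<circ> Transposition.transpose a c'"
            using c c' S(2) by (auto simp: fun_eq_iff Transposition.transpose_def)
          then have "Fc c (Transposition.transpose c c' \<circ> q) = F (Transposition.transpose c c' \<circ> (Transposition.transpose a c' \<circ> q))"
            unfolding Fc_def by (metis comp_assoc)
          then show ?thesis
            unfolding Fc_def using insert.prems(4)[OF perm[OF c(2) q]] c S by (metis insertI2)
        qed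
        then show ?thesis using permutes_swap_id[OF c(1) c'] by blast
      qed
      then obtain q' where q': "q' permutes S'"
        "\<And>q. q permutes S' \<Longrightarrow> \<bar>Fc c (q' \<circ> q) - Fc c' q\<bar> \<le> d" by blast
      have "G c - G c' = perm_avg S' (\<lambda>q. Fc c (q' \<circ> q) - Fc c' q)"
        by (simp add: perm_avg_diff G_def perm_avg_compose_left[OF q'(1), of "Fc c"])
      moreover have "perm_avg S' (\<lambda>q. Fc c (q' \<circ> q) - Fc c' q) \<le> perm_avg S' (\<lambda>_. d)"
        using q'(2) by (intro perm_avg_mono) (auto simp: abs_le_iff)
      moreover have "perm_avg S' (\<lambda>_. - d) \<le> perm_avg S' (\<lambda>q. Fc c (q' \<circ> q) - Fc c' q)"
        using q'(2) by (intro perm_avg_mono) (auto simp: abs_le_iff, smt (verit))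
      ultimately show ?thesis using S(3) by simp
    qed
    have d0: "0 \<le> d"
      using insert.prems(4)[OF permutes_id, of a a] S by auto
    have osc: "\<bar>G c - G c'\<bar> \<le> d" if "c \<in> S" "c' \<in> S" for c c'
      using osc'[of c c'] osc'[of c' c] that S d0 by (cases "c = c'") (auto simp: abs_minus_commute)
    define E where "E = exp (card J * (l\<^sup>2 * d\<^sup>2 / 8))"
    have "perm_avg S (\<lambda>p. exp (l * F p)) =
        (\<Sum>c\<in>S. perm_avg S' (\<lambda>q. exp (l * Fc c q))) / card S"
      unfolding S(1) perm_avg_insert[OF S(3,2)] Fc_def ..
    also have "\<dots> \<le> (\<Sum>c\<in>S. exp (l * G c) * E) / card S"
    proof (intro divide_right_mono sum_mono)
      fix c assume "c \<in> S"
      then show "perm_avg S' (\<lambda>q. exp (l * Fc c q)) \<le> exp (l * G c) * E"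
        using insert.IH[OF S(3,4), of "Fc c"] Fc_dep[of c] Fc_lip[of c]
        unfolding G_def E_def exp_add[symmetric] by blast
    qed simp
    also have "\<dots> = (\<Sum>c\<in>S. exp (l * G c)) / card S * E"
      by (simp add: sum_distrib_right)
    also have "\<dots> \<le> exp (l * ((\<Sum>c\<in>S. G c) / card S) + l\<^sup>2 * d\<^sup>2 / 8) * E"
      using insert.prems(1) S osc l by (intro mult_right_mono hoeffding_finite_average) (auto simp: E_def)
    also have "(\<Sum>c\<in>S. G c) / card S = perm_avg S F"
      unfolding S(1) perm_avg_insert[OF S(3,2)] G_def Fc_def ..
    also have "exp (l * perm_avg S F + l\<^sup>2 * d\<^sup>2 / 8) * E =
        exp (l * perm_avg S F + card (insert a J) * (l\<^sup>2 * d\<^sup>2 / 8))"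
      using insert.hyps by (simp add: E_def exp_add[symmetric] algebra_simps add_divide_distrib)
    finally show ?case .
  qed
qed

lemma permutation_tail:
  fixes F :: "('b \<Rightarrow> 'b) \<Rightarrow> real" and d \<mu> s :: real
  assumes S: "finite S" "J \<subseteq> S" "J \<noteq> {}"
    and dep: "\<And>p q. p permutes S \<Longrightarrow> q permutes S \<Longrightarrow> (\<And>i. i \<in> J \<Longrightarrow> p i = q i) \<Longrightarrow> F p = F q"
    and lip: "\<And>p u v. p permutes S \<Longrightarrow> u \<in> S \<Longrightarrow> v \<in> S \<Longrightarrow> \<bar>F (Transposition.transpose u v \<circ> p) - F p\<bar> \<le> d"
    and d: "d > 0" and mean: "perm_avg S F \<le> \<mu>" and s: "\<mu> < s"
  shows "perm_avg S (\<lambda>p. of_bool (s \<le> F p)) \<le> exp (- 2 * (s - \<mu>)\<^sup>2 / (card J * d\<^sup>2))"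
proof -
  define m where "m = real (card J)"
  have m: "m > 0" using S finite_subset by (fastforce simp: m_def card_gt_0_iff)
  \<comment> \<open>the exponent that minimises the Chernoff bound\<close>
  define l where "l = 4 * (s - \<mu>) / (m * d\<^sup>2)"
  have l: "l > 0" using s m d by (simp add: l_def)
  have "perm_avg S (\<lambda>p. of_bool (s \<le> F p)) \<le> perm_avg S (\<lambda>p. exp (- (l * s)) * exp (l * F p))"
    using l by (intro perm_avg_mono) (auto simp: exp_add[symmetric])
  also have "\<dots> = exp (- (l * s)) * perm_avg S (\<lambda>p. exp (l * F p))"
    by (rule perm_avg_cmult)
  also have "\<dots> \<le> exp (- (l * s)) * exp (l * perm_avg S F + m * (l\<^sup>2 * d\<^sup>2 / 8))"
    unfolding m_def by (intro mult_left_mono permutation_mgf[where F = F and d = d, OF S(1,2) dep lip l]) auto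
  also have "\<dots> \<le> exp (- (l * (s - \<mu>)) + m * (l\<^sup>2 * d\<^sup>2 / 8))"
    using mult_left_mono[OF mean, of l] l by (simp add: exp_add[symmetric] algebra_simps)
  also have "- (l * (s - \<mu>)) + m * (l\<^sup>2 * d\<^sup>2 / 8) = - 2 * (s - \<mu>)\<^sup>2 / (m * d\<^sup>2)"
    using m d unfolding l_def by (simp add: field_simps power2_eq_square)
  finally show ?thesis by (simp add: m_def)
qed

lemma perm_avg_power2_le: "finite S \<Longrightarrow> (perm_avg S F)\<^sup>2 \<le> perm_avg S (\<lambda>p. (F p)\<^sup>2)"
proof -
  assume S: "finite S"
  define \<mu> where "\<mu> = perm_avg S F"
  have "0 = perm_avg S (\<lambda>p. 0)" using S by simp
  also have "\<dots> \<le> perm_avg S (\<lambda>p. ((F p)\<^sup>2 - (2 * \<mu>) * F p) - (- \<mu>\<^sup>2))"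
  proof (rule perm_avg_mono)
    fix p
    have "(F p)\<^sup>2 - (2 * \<mu>) * F p - (- \<mu>\<^sup>2) = (F p - \<mu>)\<^sup>2" by (simp add: power2_diff)
    then show "0 \<le> (F p)\<^sup>2 - (2 * \<mu>) * F p - (- \<mu>\<^sup>2)" by simp
  qed
  also have "\<dots> = perm_avg S (\<lambda>p. (F p)\<^sup>2) - \<mu>\<^sup>2"
    unfolding perm_avg_diff perm_avg_cmult using S by (simp add: \<mu>_def[symmetric] power2_eq_square)
  finally show ?thesis by (simp add: \<mu>_def)
qed

text \<open>
  Sampling without replacement makes two different draws from a centred population nonpositively
  correlated: the inner products of one draw with all the others have the same expectation, and their
  sum is minus the squared norm of that draw.
\<close>

lemma perm_avg_inner_nonpos:
  fixes w :: "'b \<Rightarrow> 'h::real_inner"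
  assumes S: "finite S" and w: "(\<Sum>i\<in>S. w i) = 0" and ij: "i \<in> S" "j \<in> S" "i \<noteq> j"
  shows "perm_avg S (\<lambda>p. inner (w (p i)) (w (p j))) \<le> 0"
proof -
  define \<rho> where "\<rho> k = perm_avg S (\<lambda>p. inner (w (p i)) (w (p k)))" for k
  have eq: "\<rho> k = \<rho> j" if k: "k \<in> S - {i}" for k
  proof -
    have q: "Transposition.transpose j k permutes S" using k ij by (intro permutes_swap_id) auto
    have "perm_avg S (\<lambda>p. inner (w ((p \<circ> Transposition.transpose j k) i)) (w ((p \<circ> Transposition.transpose j k) j))) = \<rho> j"
      unfolding \<rho>_def by (rule perm_avg_compose_right[OF q])
    moreover have "Transposition.transpose j k i = i" using k ij by (auto simp: Transposition.transpose_def)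
    ultimately show ?thesis by (simp add: \<rho>_def)
  qed
  have "(\<Sum>k\<in>S. \<rho> k) = perm_avg S (\<lambda>p. inner (w (p i)) (\<Sum>k\<in>S. w (p k)))"
    unfolding \<rho>_def inner_sum_right perm_avg_sum ..
  also have "\<dots> = perm_avg S (\<lambda>p. 0)"
  proof (rule perm_avg_cong)
    fix p assume p: "p permutes S"
    have "(\<Sum>k\<in>S. w (p k)) = 0"
      using sum.permute[OF p, of w] w by (simp add: o_def)
    then show "inner (w (p i)) (\<Sum>k\<in>S. w (p k)) = 0" by simp
  qed
  finally have "(\<Sum>k\<in>S. \<rho> k) = 0" using S by simp
  moreover have "(\<Sum>k\<in>S. \<rho> k) = \<rho> i + (\<Sum>k\<in>S-{i}. \<rho> k)"
    using S ij by (simp add: sum.remove)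
  moreover have "(\<Sum>k\<in>S-{i}. \<rho> k) = real (card (S - {i})) * \<rho> j"
    using eq by simp
  moreover have "0 \<le> \<rho> i"
    using perm_avg_mono[of S "\<lambda>_. 0" "\<lambda>p. inner (w (p i)) (w (p i))"] S by (simp add: \<rho>_def)
  moreover have "0 < card (S - {i})"
    using S ij by (subst card_gt_0_iff) auto
  ultimately have "real (card (S - {i})) * \<rho> j \<le> 0" "0 < real (card (S - {i}))" by auto
  then have "\<rho> j \<le> 0" by (simp add: mult_le_0_iff)
  then show ?thesis by (simp add: \<rho>_def)
qed

text \<open>
  Concentration of the mean of a sample without replacement around the population mean, in an arbitrary
  inner product space and without dependence on the population size. The distance has expectation at most
  \<open>2 R / \<surd>(card J) \<le> s / 2\<close> by the second moment bound, and swapping two values of the permutation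
  changes it by at most \<open>4 R / card J\<close>.
\<close>

lemma block_mean_tail:
  fixes z :: "'b \<Rightarrow> 'h::real_inner" and R s :: real
  assumes S: "finite S" "J \<subseteq> S" "J \<noteq> {}" and R: "R > 0"
    and z: "\<And>i. i \<in> S \<Longrightarrow> norm (z i) \<le> R"
    and s: "s \<ge> 4 * R / sqrt (card J)"
  shows "perm_avg S (\<lambda>p. of_bool (s \<le> norm ((1 / card J) *\<^sub>R (\<Sum>j\<in>J. z (p j))
            - (1 / card S) *\<^sub>R (\<Sum>i\<in>S. z i))))
         \<le> exp (- (card J * s\<^sup>2) / (32 * R\<^sup>2))"
proof -
  define m where "m = real (card J)"
  have finJ: "finite J" using S finite_subset by blast
  have m: "m > 0" using S finJ by (auto simp: m_def card_gt_0_iff)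
  have cS: "card S > 0" using S by (auto simp: card_gt_0_iff)
  define zb where "zb = (1 / card S) *\<^sub>R (\<Sum>i\<in>S. z i)"
  define w where "w i = z i - zb" for i
  define F where "F p = norm ((1 / m) *\<^sub>R (\<Sum>j\<in>J. w (p j)))" for p
  have F_eq: "F p = norm ((1 / card J) *\<^sub>R (\<Sum>j\<in>J. z (p j)) - zb)" for p
    using m by (simp add: F_def w_def sum_subtractf scaleR_diff_right sum_constant_scaleR m_def[symmetric])
  have w0: "(\<Sum>i\<in>S. w i) = 0"
    using cS by (simp add: w_def zb_def sum_subtractf sum_constant_scaleR)
  have "norm zb \<le> (1 / card S) * (\<Sum>i\<in>S. R)"
    unfolding zb_def norm_scaleR using z by (intro mult_mono sum_norm_le) auto
  then have zb: "norm zb \<le> R" using cS by simp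
  have w_le: "norm (w i) \<le> 2 * R" if "i \<in> S" for i
    using norm_triangle_ineq4[of "z i" zb] z[OF that] zb by (simp add: w_def)
  have "perm_avg S (\<lambda>p. (F p)\<^sup>2) =
      perm_avg S (\<lambda>p. (1 / m\<^sup>2) * (\<Sum>i\<in>J. \<Sum>j\<in>J. inner (w (p i)) (w (p j))))"
    by (rule perm_avg_cong)
      (simp add: F_def power_mult_distrib power_divide power2_norm_eq_inner inner_sum_left inner_sum_right,
        subst sum.swap, simp)
  also have "\<dots> = (1 / m\<^sup>2) * (\<Sum>i\<in>J. \<Sum>j\<in>J. perm_avg S (\<lambda>p. inner (w (p i)) (w (p j))))"
    by (simp only: perm_avg_cmult perm_avg_sum)
  also have "\<dots> \<le> (1 / m\<^sup>2) * (\<Sum>i\<in>J. \<Sum>j\<in>J. if i = j then 4 * R\<^sup>2 else 0)"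
  proof (intro mult_left_mono sum_mono)
    fix i j assume ij: "i \<in> J" "j \<in> J"
    show "perm_avg S (\<lambda>p. inner (w (p i)) (w (p j))) \<le> (if i = j then 4 * R\<^sup>2 else 0)"
    proof (cases "i = j")
      case True
      have "perm_avg S (\<lambda>p. inner (w (p i)) (w (p i))) \<le> perm_avg S (\<lambda>p. (2 * R)\<^sup>2)"
        unfolding power2_norm_eq_inner[symmetric]
        using ij S w_le by (intro perm_avg_mono power_mono) (auto simp: permutes_in_image)
      then show ?thesis using True S by simp
    qed (use ij S w0 perm_avg_inner_nonpos[of S w i j] in auto)
  qed simp
  also have "\<dots> = 4 * R\<^sup>2 / m"
    using finJ m by (simp add: m_def[symmetric] power2_eq_square)
  finally have second: "perm_avg S (\<lambda>p. (F p)\<^sup>2) \<le> (2 * R / sqrt m)\<^sup>2"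
    using m by (simp add: power_divide power_mult_distrib)
  have mean: "perm_avg S F \<le> 2 * R / sqrt m"
    by (rule power2_le_imp_le[OF order_trans[OF perm_avg_power2_le[OF S(1)] second]]) (use R m in simp)
  have lip: "\<bar>F (Transposition.transpose u v \<circ> p) - F p\<bar> \<le> 4 * R / m"
    if p: "p permutes S" and uv: "u \<in> S" "v \<in> S" for p u v
  proof -
    define D where "D j = z (Transposition.transpose u v (p j)) - z (p j)" for j
    \<comment> \<open>at most two summands are affected by the swap\<close>
    define J' where "J' = {j \<in> J. p j \<in> {u, v}}"
    have "inj_on p J'" using permutes_inj[OF p] by (rule inj_on_subset) simp
    then have "card J' = card (p ` J')" by (simp add: card_image)
    also have "\<dots> \<le> card {u, v}" by (intro card_mono) (auto simp: J'_def)
    also have "\<dots> \<le> 2" by (simp add: card_insert_if)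
    finally have cardJ': "real (card J') \<le> 2" by simp
    have "(\<Sum>j\<in>J. D j) = (\<Sum>j\<in>J'. D j)"
      using finJ by (intro sum.mono_neutral_right) (auto simp: J'_def D_def Transposition.transpose_def)
    also have "norm \<dots> \<le> (\<Sum>j\<in>J'. 2 * R)"
    proof (rule sum_norm_le)
      fix j assume "j \<in> J'"
      then have "p j \<in> S" "Transposition.transpose u v (p j) \<in> S" using uv by (auto simp: J'_def)
      then have "norm (z (p j)) \<le> R" "norm (z (Transposition.transpose u v (p j))) \<le> R"
        using z by blast+
      then show "norm (D j) \<le> 2 * R"
        using norm_triangle_ineq4[of "z (Transposition.transpose u v (p j))" "z (p j)"]
        unfolding D_def by linarith
    qed
    also have "\<dots> \<le> 2 * (2 * R)"
      using cardJ' R mult_right_mono[of _ 2 "2 * R"] by simp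
    finally have D: "norm (\<Sum>j\<in>J. D j) \<le> 4 * R" by simp
    have "\<bar>F (Transposition.transpose u v \<circ> p) - F p\<bar> \<le>
        norm ((1 / m) *\<^sub>R (\<Sum>j\<in>J. w ((Transposition.transpose u v \<circ> p) j)) - (1 / m) *\<^sub>R (\<Sum>j\<in>J. w (p j)))"
      unfolding F_def by (rule norm_triangle_ineq3)
    also have "\<dots> = norm ((1 / m) *\<^sub>R (\<Sum>j\<in>J. D j))"
      by (simp add: D_def w_def scaleR_diff_right[symmetric] sum_subtractf[symmetric])
    also have "\<dots> \<le> 4 * R / m" using D m by (simp add: divide_right_mono)
    finally show ?thesis .
  qed
  have s2: "2 * R / sqrt m \<le> s / 2" using s by (simp add: m_def)
  have "0 < 2 * R / sqrt m" using R m by simp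
  then have spos: "0 < s" using s2 by linarith
  have "perm_avg S (\<lambda>p. of_bool (s \<le> F p)) \<le> exp (- 2 * (s - s / 2)\<^sup>2 / (card J * (4 * R / m)\<^sup>2))"
  proof (rule permutation_tail[where F = F and \<mu> = "s / 2" and d = "4 * R / m", OF S])
    show "F p = F q" if "\<And>i. i \<in> J \<Longrightarrow> p i = q i" for p q
      unfolding F_def using that by simp
    show "perm_avg S F \<le> s / 2" using mean s2 by linarith
    show "s / 2 < s" using spos by simp
    show "0 < 4 * R / m" using R m by simp
  qed (fact lip)
  also have "- 2 * (s - s / 2)\<^sup>2 / (card J * (4 * R / m)\<^sup>2) = - (card J * s\<^sup>2) / (32 * R\<^sup>2)"
    using m R by (simp add: m_def[symmetric] field_simps power2_eq_square)
  finally show ?thesis unfolding F_eq zb_def .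
qed

section \<open>Chebyshev's inequality for empirical kernel means\<close>

lemma distr_PiM_two_components:
  assumes Q: "\<And>i. i \<in> I \<Longrightarrow> prob_space (Q i)" and ij: "i \<in> I" "j \<in> I" "i \<noteq> j"
  shows "distr (Pi\<^sub>M I Q) (Q i \<Otimes>\<^sub>M Q j) (\<lambda>x. (x i, x j)) = Q i \<Otimes>\<^sub>M Q j"
proof (rule pair_measure_eqI[symmetric])
  show "sigma_finite_measure (Q i)" "sigma_finite_measure (Q j)"
    using Q ij prob_space_imp_sigma_finite by blast+
  fix A B assume AB: "A \<in> sets (Q i)" "B \<in> sets (Q j)"
  define X where "X k = (if k = i then A else B)" for k
  have "emeasure (distr (Pi\<^sub>M I Q) (Q i \<Otimes>\<^sub>M Q j) (\<lambda>x. (x i, x j))) (A \<times> B)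
      = emeasure (Pi\<^sub>M I Q) ((\<lambda>x. (x i, x j)) -` (A \<times> B) \<inter> space (Pi\<^sub>M I Q))"
    using ij AB by (intro emeasure_distr) auto
  also have "(\<lambda>x. (x i, x j)) -` (A \<times> B) \<inter> space (Pi\<^sub>M I Q) = prod_emb I Q {i, j} (Pi\<^sub>E {i, j} X)"
    using ij by (auto simp: prod_emb_def space_PiM X_def PiE_iff split: if_splits)
  also have "emeasure (Pi\<^sub>M I Q) \<dots> = (\<Prod>k\<in>{i, j}. emeasure (Q k) (X k))"
    using Q ij AB by (intro emeasure_PiM_emb) (auto simp: X_def)
  also have "\<dots> = emeasure (Q i) A * emeasure (Q j) B"
    using ij by (simp add: X_def)
  finally show "emeasure (Q i) A * emeasure (Q j) B =
      emeasure (distr (Pi\<^sub>M I Q) (Q i \<Otimes>\<^sub>M Q j) (\<lambda>x. (x i, x j))) (A \<times> B)" ..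
qed simp

text \<open>
  Chebyshev's inequality for the mean of the independent feature vectors \<open>\<psi>(x j)\<close>, \<open>j \<in> J\<close>, with common
  law \<open>P\<close>. The squared deviation is a double sum of values of the centred kernel \<open>g\<close>, whose off-diagonal
  terms have expectation zero. Thus only real-valued integrals on \<open>P \<Otimes> P\<close> are needed, and no strong
  measurability of \<open>\<psi>\<close>.
\<close>

lemma empirical_mean_deviation:
  fixes \<psi> :: "'a \<Rightarrow> 'h::{real_inner,complete_space}" and R s :: real
  assumes Q: "\<And>i. i \<in> I \<Longrightarrow> prob_space (Q i)"
    and J: "finite J" "J \<noteq> {}" "J \<subseteq> I" "\<And>j. j \<in> J \<Longrightarrow> Q j = P"
    and feature: "feature_map (space P) h \<psi>"
    and h[measurable]: "(\<lambda>(x, y). h x y) \<in> borel_measurable (P \<Otimes>\<^sub>M P)"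
    and R: "\<And>x. x \<in> space P \<Longrightarrow> norm (\<psi> x) \<le> R"
    and s: "s > 0"
  defines "dev \<equiv> \<lambda>x. norm ((1 / card J) *\<^sub>R (\<Sum>j\<in>J. \<psi> (x j)) - kernel_mean P \<psi>)"
  shows "{x \<in> space (Pi\<^sub>M I Q). s \<le> dev x} \<in> sets (Pi\<^sub>M I Q)" (is "?A \<in> _")
    and "emeasure (Pi\<^sub>M I Q) {x \<in> space (Pi\<^sub>M I Q). s \<le> dev x} \<le> ennreal (4 * R\<^sup>2 / (card J * s\<^sup>2))"
proof -
  define \<Omega> where "\<Omega> = Pi\<^sub>M I Q"
  interpret \<Omega>: prob_space \<Omega> unfolding \<Omega>_def using Q by (rule prob_space_PiM)
  interpret P: prob_space P using J Q by (metis all_not_in_conv subsetD)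
  interpret PP: pair_prob_space P P ..
  have c: "0 < real (card J)" using J by (simp add: card_gt_0_iff)
  define m where "m = kernel_mean P \<psi>"
  have weak[measurable]: "(\<lambda>x. inner (\<psi> x) f) \<in> borel_measurable P" for f
    using feature h by (rule feature_map_weakly_measurable)
  have mean: "has_bochner_integral P (\<lambda>x. inner (\<psi> x) f) (inner m f)" for f
    unfolding m_def using P.prob_space_axioms weak R by (rule has_kernel_mean)
  obtain x0 where x0: "x0 \<in> space P" using P.not_empty by blast
  have R0: "0 \<le> R" using R[OF x0] norm_ge_zero order_trans by blast
  have m_le: "norm m \<le> R"
  proof -
    have "inner m m = (\<integral>x. inner (\<psi> x) m \<partial>P)"
      using mean by (simp add: has_bochner_integral_iff)
    also have "\<dots> \<le> (\<integral>x. R * norm m \<partial>P)"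
    proof (rule integral_mono)
      show "inner (\<psi> x) m \<le> R * norm m" if "x \<in> space P" for x
        using norm_cauchy_schwarz[of "\<psi> x" m] R[OF that] mult_right_mono[of "norm (\<psi> x)" R "norm m"]
        by simp
    qed (use mean in \<open>auto simp: has_bochner_integral_iff\<close>)
    finally have "norm m * norm m \<le> R * norm m"
      by (simp add: P.prob_space flip: power2_norm_eq_inner power2_eq_square)
    then show ?thesis using R0 by (cases "m = 0") auto
  qed
  define g where "g = (\<lambda>(x, y). inner (\<psi> x - m) (\<psi> y - m))"
  have g_meas[measurable]: "g \<in> borel_measurable (P \<Otimes>\<^sub>M P)"
  proof -
    let ?f = "\<lambda>z. (case z of (x, y) \<Rightarrow> h x y) - inner (\<psi> (fst z)) m - inner (\<psi> (snd z)) m + inner m m"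
    have "g z = ?f z" if "z \<in> space (P \<Otimes>\<^sub>M P)" for z
    proof -
      obtain x y where z: "z = (x, y)" "x \<in> space P" "y \<in> space P"
        using \<open>z \<in> space (P \<Otimes>\<^sub>M P)\<close> by (auto simp: space_pair_measure)
      have "h x y = inner (\<psi> x) (\<psi> y)" using feature z by (simp add: feature_map_def)
      then show ?thesis
        by (simp add: z(1) g_def inner_diff_left inner_diff_right inner_commute[of m "\<psi> y"])
    qed
    moreover have "?f \<in> borel_measurable (P \<Otimes>\<^sub>M P)" by measurable
    ultimately show ?thesis using measurable_cong[of "P \<Otimes>\<^sub>M P" g ?f borel] by blast
  qed
  have psi_m: "norm (\<psi> x - m) \<le> 2 * R" if "x \<in> space P" for x
    using norm_triangle_ineq4[of "\<psi> x" m] R[OF that] m_le by simp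
  have g_le: "\<bar>g (x, y)\<bar> \<le> 4 * R\<^sup>2" if "x \<in> space P" "y \<in> space P" for x y
    using Cauchy_Schwarz_ineq2[of "\<psi> x - m" "\<psi> y - m"]
      mult_mono[OF psi_m[OF that(1)] psi_m[OF that(2)]] R0
    by (simp add: g_def power2_eq_square)
  have g_int: "integrable (P \<Otimes>\<^sub>M P) g"
    by (rule PP.P.integrable_const_bound[where B = "4 * R\<^sup>2"])
      (use g_le in \<open>auto simp: space_pair_measure\<close>)
  have g_0: "(\<integral>z. g z \<partial>(P \<Otimes>\<^sub>M P)) = 0"
  proof -
    have "(\<integral>y. g (x, y) \<partial>P) = 0" for x
    proof -
      have "has_bochner_integral P (\<lambda>y. inner (\<psi> y) (\<psi> x - m) - inner m (\<psi> x - m))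
          (inner m (\<psi> x - m) - inner m (\<psi> x - m))"
        using has_bochner_integral_diff[OF mean[of "\<psi> x - m"], of "\<lambda>_. inner m (\<psi> x - m)"]
        by (simp add: has_bochner_integral_iff P.prob_space)
      then show ?thesis
        by (simp add: g_def has_bochner_integral_iff inner_diff_left[symmetric]
            inner_commute[of "\<psi> x - m"])
    qed
    then show ?thesis using PP.integral_fst'[OF g_int] by simp
  qed
  have comp: "(\<lambda>x. (x i, x j)) \<in> measurable \<Omega> (P \<Otimes>\<^sub>M P)" if "i \<in> J" "j \<in> J" for i j
  proof -
    have "(\<lambda>x. (x i, x j)) \<in> measurable \<Omega> (Q i \<Otimes>\<^sub>M Q j)"
      unfolding \<Omega>_def using that J(3) by (intro measurable_Pair measurable_component_singleton) auto
    then show ?thesis using J(4) that by simp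
  qed
  have comp_space: "x j \<in> space P" if "j \<in> J" "x \<in> space \<Omega>" for j x
    using that J(3,4) by (fastforce simp: \<Omega>_def space_PiM PiE_iff)
  have G_meas: "(\<lambda>x. g (x i, x j)) \<in> borel_measurable \<Omega>" if "i \<in> J" "j \<in> J" for i j
    using comp[OF that] g_meas by (rule measurable_compose)
  have G_int: "integrable \<Omega> (\<lambda>x. g (x i, x j))" if "i \<in> J" "j \<in> J" for i j
    by (rule \<Omega>.integrable_const_bound[where B = "4 * R\<^sup>2"])
      (use g_le comp_space G_meas that in auto)
  have G_le: "(\<integral>x. g (x i, x j) \<partial>\<Omega>) \<le> (if i = j then 4 * R\<^sup>2 else 0)" if ij: "i \<in> J" "j \<in> J" for i j
  proof (cases "i = j")
    case True
    have "(\<integral>x. g (x i, x j) \<partial>\<Omega>) \<le> (\<integral>x. 4 * R\<^sup>2 \<partial>\<Omega>)"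
      using G_int[OF ij] g_le comp_space ij by (intro integral_mono) (auto simp: abs_le_iff)
    then show ?thesis using True by (simp add: \<Omega>.prob_space)
  next
    case False
    have "distr \<Omega> (P \<Otimes>\<^sub>M P) (\<lambda>x. (x i, x j)) = P \<Otimes>\<^sub>M P"
      using distr_PiM_two_components[where I = I and Q = Q and i = i and j = j, OF Q] ij J(3,4) False by (auto simp: \<Omega>_def)
    then have "(\<integral>x. g (x i, x j) \<partial>\<Omega>) = (\<integral>z. g z \<partial>(P \<Otimes>\<^sub>M P))"
      using integral_distr[OF comp[OF ij] g_meas] by simp
    then show ?thesis using g_0 False by simp
  qed
  define U where "U x = (\<Sum>i\<in>J. \<Sum>j\<in>J. g (x i, x j)) / (card J)\<^sup>2" for x
  have U: "U x = (dev x)\<^sup>2" for x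
  proof -
    have "dev x = norm ((1 / card J) *\<^sub>R (\<Sum>j\<in>J. \<psi> (x j) - m))"
      using c by (simp add: dev_def m_def sum_subtractf scaleR_diff_right sum_constant_scaleR)
    then have "(dev x)\<^sup>2 = (1 / card J)\<^sup>2 * inner (\<Sum>i\<in>J. \<psi> (x i) - m) (\<Sum>j\<in>J. \<psi> (x j) - m)"
      by (simp add: power_mult_distrib power_divide power2_norm_eq_inner)
    also have "\<dots> = U x"
      unfolding U_def g_def inner_sum_left inner_sum_right
      by (subst sum.swap) (simp add: power_divide)
    finally show ?thesis by simp
  qed
  have U_int: "integrable \<Omega> U"
    unfolding U_def by (intro integrable_divide_zero Bochner_Integration.integrable_sum G_int) auto
  have set_eq: "{x \<in> space \<Omega>. s \<le> dev x} = {x \<in> space \<Omega>. s\<^sup>2 \<le> U x}"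
    unfolding U using s by (auto simp: dev_def power2_le_iff_abs_le)
  have "U \<in> borel_measurable \<Omega>" using U_int by (rule borel_measurable_integrable)
  then have "{x \<in> space \<Omega>. s\<^sup>2 \<le> U x} \<in> sets \<Omega>" by measurable
  then show "?A \<in> sets (Pi\<^sub>M I Q)" using set_eq by (simp add: \<Omega>_def)
  have "(\<integral>x. U x \<partial>\<Omega>) = (\<Sum>i\<in>J. \<Sum>j\<in>J. \<integral>x. g (x i, x j) \<partial>\<Omega>) / (card J)\<^sup>2"
    unfolding U_def by (simp add: Bochner_Integration.integral_sum G_int Bochner_Integration.integrable_sum)
  also have "\<dots> \<le> (\<Sum>i\<in>J. \<Sum>j\<in>J. if i = j then 4 * R\<^sup>2 else 0) / (card J)\<^sup>2"
    by (intro divide_right_mono sum_mono G_le) auto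
  also have "\<dots> = 4 * R\<^sup>2 / card J"
    using J(1) c by (simp add: power2_eq_square)
  finally have EU: "(\<integral>x. U x \<partial>\<Omega>) \<le> 4 * R\<^sup>2 / card J" .
  have "emeasure \<Omega> {x \<in> space \<Omega>. s\<^sup>2 \<le> U x} \<le> ennreal ((1 / s\<^sup>2) * (\<integral>x. U x \<partial>\<Omega>))"
    using s by (intro integral_Markov_inequality U_int) (auto simp: U)
  also have "\<dots> \<le> ennreal ((1 / s\<^sup>2) * (4 * R\<^sup>2 / card J))"
    by (intro ennreal_leI mult_left_mono EU) auto
  also have "(1 / s\<^sup>2) * (4 * R\<^sup>2 / card J) = 4 * R\<^sup>2 / (card J * s\<^sup>2)"
    by (simp add: field_simps)
  finally show "emeasure (Pi\<^sub>M I Q) ?A \<le> ennreal (4 * R\<^sup>2 / (card J * s\<^sup>2))"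
    using set_eq by (simp add: \<Omega>_def)
qed

section \<open>Pooled data and maxima over pairs\<close>

text \<open>
  The numbers, in the pooled data, of the observations of sample \<open>k\<close>.
\<close>

definition block :: "(nat \<Rightarrow> nat) \<Rightarrow> nat \<Rightarrow> nat set" where
  "block n k = (\<lambda>i. offset n k + i) ` {1..n k}"

lemma card_block [simp]: "card (block n k) = n k"
  unfolding block_def by (subst card_image) (auto intro!: inj_onI)

lemma sum_block: "(\<Sum>j\<in>block n k. f j) = (\<Sum>i=1..n k. f (offset n k + i))"
  unfolding block_def by (subst sum.reindex) (auto intro!: inj_onI)

lemma offset_add: "1 \<le> k \<Longrightarrow> offset n k + n k = (\<Sum>j=1..k. n j)"
  by (cases k) (simp_all add: offset_def atLeastLessThanSuc_atLeastAtMost)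

lemma block_subset:
  assumes "k \<in> {1..K}"
  shows "block n k \<subseteq> {1..total_size K n}"
proof -
  have "offset n k + n k \<le> total_size K n"
    using assms unfolding total_size_def by (subst offset_add) (auto intro!: sum_mono2)
  then show ?thesis by (auto simp: block_def)
qed

lemma pool_is_observation:
  assumes m: "m \<in> {1..total_size K n}"
  obtains k i where "k \<in> {1..K}" "i \<in> {1..n k}" "pool n x m = x (k, i)"
proof -
  define k where "k = sample_of n m"
  have K: "m \<le> (\<Sum>j=1..K. n j)" using m by (simp add: total_size_def)
  then have k: "m \<le> (\<Sum>j=1..k. n j)" "k \<le> K"
    unfolding k_def sample_of_def by (rule LeastI, rule Least_le)
  have "k \<noteq> 0" using k(1) m by (intro notI) simp
  moreover from this have "\<not> m \<le> (\<Sum>j=1..k - 1. n j)"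
    unfolding k_def sample_of_def by (intro not_less_Least) auto
  moreover have "offset n k = (\<Sum>j=1..k - 1. n j)"
    using \<open>k \<noteq> 0\<close> by (cases k) (simp_all add: offset_def atLeastLessThanSuc_atLeastAtMost)
  ultimately show ?thesis
    using k offset_add[of k n] by (intro that[of k "m - offset n k"]) (auto simp: pool_def k_def)
qed

lemma finite_index_pairs: "finite (index_pairs K)"
  by (rule finite_subset[of _ "{1..K} \<times> {1..K}"]) (auto simp: index_pairs_def)

lemma index_pairs_nonempty: "K \<ge> 2 \<Longrightarrow> index_pairs K \<noteq> {}"
proof -
  assume "K \<ge> 2"
  then have "(1, 2) \<in> index_pairs K" by (simp add: index_pairs_def)
  then show ?thesis by blast
qed

lemma Max_index_pairs_obtain:
  assumes "K \<ge> 2" and "s \<le> (MAX (k, l)\<in>index_pairs K. f k l :: real)"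
  obtains k l where "k \<in> {1..K}" "l \<in> {1..K}" "(k, l) \<in> index_pairs K" "s \<le> f k l"
proof -
  have "(MAX (k, l)\<in>index_pairs K. f k l) \<in> (\<lambda>(k, l). f k l) ` index_pairs K"
    using assms(1) finite_index_pairs index_pairs_nonempty by (intro Max_in) auto
  with assms(2) that show ?thesis by (auto simp: index_pairs_def)
qed

lemma n_min_le: "k \<in> {1..K} \<Longrightarrow> n_min K n \<le> n k"
  unfolding n_min_def by (intro Min_le) auto

lemma permuted_statistic_eq:
  "permuted_statistic \<psi> K n x p =
    (MAX (k, l)\<in>index_pairs K.
      norm ((1 / real (n k)) *\<^sub>R (\<Sum>j\<in>block n k. \<psi> (pool n x (p j)))
          - (1 / real (n l)) *\<^sub>R (\<Sum>j\<in>block n l. \<psi> (pool n x (p j)))))"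
  unfolding permuted_statistic_def statistic_def split_samples_def sum_block by simp

section \<open>The p-value and the type II error\<close>

text \<open>
  A bound on the permutation p-value for every fixed data set, in terms of a lower bound \<open>s\<close> on the
  observed statistic. A permuted statistic of size \<open>s\<close> forces the mean of some permuted sample to be at
  distance at least \<open>s / 2\<close> from the pooled mean; this is a union over the \<open>K\<close> samples, not over the pairs.
\<close>

lemma p_perm_le:
  fixes \<psi> :: "'a \<Rightarrow> 'h::{real_inner,complete_space}" and R s :: real
  assumes K: "K \<ge> 2" and pos: "n_min K n \<ge> 1"
    and R: "R > 0" "\<And>k i. k \<in> {1..K} \<Longrightarrow> i \<in> {1..n k} \<Longrightarrow> norm (\<psi> (x (k, i))) \<le> R"
    and s: "s \<le> statistic \<psi> K n x" "8 * R / sqrt (n_min K n) \<le> s"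
  shows "p_perm \<psi> K n x \<le> K * exp (- (n_min K n * s\<^sup>2) / (128 * R\<^sup>2))"
proof -
  define S where "S = {1..total_size K n}"
  define z where "z m = \<psi> (pool n x m)" for m
  define zb where "zb = (1 / card S) *\<^sub>R (\<Sum>i\<in>S. z i)"
  define F where "F k p = norm ((1 / n k) *\<^sub>R (\<Sum>j\<in>block n k. z (p j)) - zb)" for k and p :: "nat \<Rightarrow> nat"
  have z: "norm (z m) \<le> R" if m: "m \<in> S" for m
    using m[unfolded S_def] by (rule pool_is_observation[where x = x]) (simp add: z_def R)
  have union: "of_bool (statistic \<psi> K n x \<le> permuted_statistic \<psi> K n x p)
      \<le> (\<Sum>k=1..K. of_bool (s / 2 \<le> F k p) :: real)" for p
  proof (cases "statistic \<psi> K n x \<le> permuted_statistic \<psi> K n x p")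
    case True
    then have "s \<le> permuted_statistic \<psi> K n x p" using s by simp
    then obtain k l where kl: "k \<in> {1..K}" "l \<in> {1..K}"
      "s \<le> norm ((1 / real (n k)) *\<^sub>R (\<Sum>j\<in>block n k. z (p j))
               - (1 / real (n l)) *\<^sub>R (\<Sum>j\<in>block n l. z (p j)))"
      unfolding permuted_statistic_eq z_def by (rule Max_index_pairs_obtain[OF K])
    have "s \<le> F k p + F l p"
      unfolding F_def using kl(3) norm_triangle_ineq4[of
          "(1 / real (n k)) *\<^sub>R (\<Sum>j\<in>block n k. z (p j)) - zb"
          "(1 / real (n l)) *\<^sub>R (\<Sum>j\<in>block n l. z (p j)) - zb"] by simp
    then obtain k' where k': "k' \<in> {1..K}" "s / 2 \<le> F k' p"
      using kl(1,2) by (cases "s / 2 \<le> F k p") (force, smt (verit) field_sum_of_halves)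
    have "of_bool (s / 2 \<le> F k' p) \<le> (\<Sum>k=1..K. of_bool (s / 2 \<le> F k p) :: real)"
      using k'(1) by (intro member_le_sum) auto
    then show ?thesis using k'(2) by simp
  qed (simp add: sum_nonneg)
  have "p_perm \<psi> K n x = perm_avg S (\<lambda>p. of_bool (statistic \<psi> K n x \<le> permuted_statistic \<psi> K n x p))"
    unfolding p_perm_def perm_avg_def S_def by simp
  also have "\<dots> \<le> perm_avg S (\<lambda>p. \<Sum>k=1..K. of_bool (s / 2 \<le> F k p))"
    by (intro perm_avg_mono union)
  also have "\<dots> = (\<Sum>k=1..K. perm_avg S (\<lambda>p. of_bool (s / 2 \<le> F k p)))"
    by (rule perm_avg_sum)
  also have "\<dots> \<le> (\<Sum>k=1..K. exp (- (n_min K n * s\<^sup>2) / (128 * R\<^sup>2)))"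
  proof (rule sum_mono)
    fix k assume k: "k \<in> {1..K}"
    have nk: "n_min K n \<le> n k" using k by (rule n_min_le)
    have ne: "block n k \<noteq> {}" using nk pos by (simp add: block_def)
    have "4 * R / sqrt (n k) \<le> 4 * R / sqrt (n_min K n)"
      using nk pos R by (intro divide_left_mono) auto
    also have "\<dots> \<le> s / 2" using s(2) by simp
    finally have "perm_avg S (\<lambda>p. of_bool (s / 2 \<le> F k p)) \<le> exp (- (n k * (s / 2)\<^sup>2) / (32 * R\<^sup>2))"
      unfolding F_def zb_def
      using block_mean_tail[of S "block n k" R z "s / 2"] block_subset[OF k] ne R(1) z
      by (simp add: S_def)
    also have "- (n k * (s / 2)\<^sup>2) / (32 * R\<^sup>2) = - (n k * s\<^sup>2) / (128 * R\<^sup>2)"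
      by (simp add: power_divide)
    also have "exp \<dots> \<le> exp (- (n_min K n * s\<^sup>2) / (128 * R\<^sup>2))"
      using nk by (auto intro!: divide_right_mono mult_right_mono)
    finally show "perm_avg S (\<lambda>p. of_bool (s / 2 \<le> F k p)) \<le> exp (- (n_min K n * s\<^sup>2) / (128 * R\<^sup>2))" .
  qed
  also have "\<dots> = K * exp (- (n_min K n * s\<^sup>2) / (128 * R\<^sup>2))" by simp
  finally show ?thesis .
qed

text \<open>
  Under an alternative with separation \<open>\<epsilon>\<close> it suffices to control the empirical means of the two samples
  at which the largest discrepancy is attained: unless one of them deviates by \<open>\<epsilon> / 4\<close>, the statistic is
  at least \<open>\<epsilon> / 2\<close>, and then the p-value is at most \<open>\<alpha>\<close>.
\<close>

lemma worst_type_II_error_le: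
  fixes M :: "'a measure" and \<psi> :: "'a \<Rightarrow> 'h::{real_inner,complete_space}" and R \<epsilon> \<alpha> :: real
  assumes feature: "feature_map (space M) h \<psi>"
    and h: "(\<lambda>(x, y). h x y) \<in> borel_measurable (M \<Otimes>\<^sub>M M)"
    and R: "R > 0" "\<And>x. x \<in> space M \<Longrightarrow> norm (\<psi> x) \<le> R"
    and K: "K \<ge> 2" and pos: "n_min K n \<ge> 1" and \<epsilon>: "\<epsilon> > 0"
    and large: "16 * R / sqrt (n_min K n) \<le> \<epsilon>"
    and level: "K * exp (- (n_min K n * \<epsilon>\<^sup>2) / (512 * R\<^sup>2)) \<le> \<alpha>"
  shows "worst_type_II_error M \<psi> K n \<alpha> \<epsilon> \<le> ennreal (128 * R\<^sup>2 / (n_min K n * \<epsilon>\<^sup>2))"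
  unfolding worst_type_II_error_def
proof (rule SUP_least)
  fix P assume P: "P \<in> alternatives M \<psi> K \<epsilon>"
  define Q where "Q = (\<lambda>(k::nat, i::nat). P k)"
  define I where "I = (SIGMA k:{1..K}. {1..n k})"
  define \<Omega> where "\<Omega> = sample_law K n P"
  have \<Omega>: "\<Omega> = Pi\<^sub>M I Q" by (simp add: \<Omega>_def sample_law_def I_def Q_def)
  have prob: "prob_space (P k)" and sets: "sets (P k) = sets M" if "k \<in> {1..K}" for k
    using P that by (auto simp: alternatives_def)
  have space: "space (P k) = space M" if "k \<in> {1..K}" for k
    using sets[OF that] by (rule sets_eq_imp_space_eq)
  have Q: "prob_space (Q i)" if "i \<in> I" for i
    using that prob by (auto simp: Q_def I_def)
  define mean where "mean k x = (1 / real (n k)) *\<^sub>R (\<Sum>i=1..n k. \<psi> (x (k, i)))"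
    for k and x :: "nat \<times> nat \<Rightarrow> 'a"
  define A where "A k = {x \<in> space \<Omega>. \<epsilon> / 4 \<le> norm (mean k x - kernel_mean (P k) \<psi>)}" for k
  have A: "A k \<in> sets \<Omega>" "emeasure \<Omega> (A k) \<le> ennreal (64 * R\<^sup>2 / (n_min K n * \<epsilon>\<^sup>2))"
    if k: "k \<in> {1..K}" for k
  proof -
    define J where "J = Pair k ` {1..n k}"
    have nk: "n_min K n \<le> n k" using k by (rule n_min_le)
    have J: "finite J" "J \<noteq> {}" "J \<subseteq> I" "\<And>j. j \<in> J \<Longrightarrow> Q j = P k"
      using k nk pos by (auto simp: J_def I_def Q_def)
    have card: "card J = n k" unfolding J_def by (subst card_image) (auto intro!: inj_onI)
    have sum: "(\<Sum>j\<in>J. \<psi> (x j)) = (\<Sum>i=1..n k. \<psi> (x (k, i)))" for x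
      unfolding J_def by (subst sum.reindex) (auto intro!: inj_onI)
    have h': "(\<lambda>(x, y). h x y) \<in> borel_measurable (P k \<Otimes>\<^sub>M P k)"
      using h measurable_cong_sets[OF sets_pair_measure_cong[OF sets[OF k] sets[OF k]] refl] by blast
    have feature': "feature_map (space (P k)) h \<psi>" using feature space[OF k] by simp
    have R': "\<And>x. x \<in> space (P k) \<Longrightarrow> norm (\<psi> x) \<le> R" using R(2) space[OF k] by simp
    have \<epsilon>': "0 < \<epsilon> / 4" using \<epsilon> by simp
    note dev = empirical_mean_deviation[OF Q J feature' h' R' \<epsilon>', unfolded card sum]
    show "A k \<in> sets \<Omega>"
      using dev(1) by (simp add: A_def mean_def \<Omega>)
    have "emeasure \<Omega> (A k) \<le> ennreal (4 * R\<^sup>2 / (n k * (\<epsilon> / 4)\<^sup>2))"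
      using dev(2) by (simp add: A_def mean_def \<Omega>)
    also have "4 * R\<^sup>2 / (n k * (\<epsilon> / 4)\<^sup>2) = 64 * R\<^sup>2 / (n k * \<epsilon>\<^sup>2)"
      by (simp add: power_divide)
    also have "ennreal \<dots> \<le> ennreal (64 * R\<^sup>2 / (n_min K n * \<epsilon>\<^sup>2))"
      using nk pos \<epsilon> by (intro ennreal_leI divide_left_mono mult_right_mono) auto
    finally show "emeasure \<Omega> (A k) \<le> ennreal (64 * R\<^sup>2 / (n_min K n * \<epsilon>\<^sup>2))" .
  qed
  have "\<epsilon> \<le> (MAX (k, l)\<in>index_pairs K. mmd \<psi> (P k) (P l))" using P by (simp add: alternatives_def)
  then obtain k l where kl: "k \<in> {1..K}" "l \<in> {1..K}" "(k, l) \<in> index_pairs K"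
    "\<epsilon> \<le> mmd \<psi> (P k) (P l)" by (rule Max_index_pairs_obtain[OF K])
  have sub: "{x \<in> space \<Omega>. perm_test \<psi> K n \<alpha> x = 0} \<subseteq> A k \<union> A l"
  proof (rule subsetI, rule ccontr)
    fix x assume x: "x \<in> {x \<in> space \<Omega>. perm_test \<psi> K n \<alpha> x = 0}" and notA: "x \<notin> A k \<union> A l"
    have dev: "norm (mean k x - kernel_mean (P k) \<psi>) < \<epsilon> / 4"
      "norm (mean l x - kernel_mean (P l) \<psi>) < \<epsilon> / 4"
      using x notA by (auto simp: A_def)
    have "norm (kernel_mean (P k) \<psi> - kernel_mean (P l) \<psi>) \<le>
        norm (mean k x - mean l x) + norm ((mean k x - kernel_mean (P k) \<psi>) - (mean l x - kernel_mean (P l) \<psi>))"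
      using norm_triangle_ineq4[of "mean k x - mean l x"
          "(mean k x - kernel_mean (P k) \<psi>) - (mean l x - kernel_mean (P l) \<psi>)"]
      by (simp add: algebra_simps)
    then have "\<epsilon> / 2 \<le> norm (mean k x - mean l x)"
      using kl(4) dev norm_triangle_ineq4[of "mean k x - kernel_mean (P k) \<psi>" "mean l x - kernel_mean (P l) \<psi>"]
      unfolding mmd_def by linarith
    also have "\<dots> \<le> statistic \<psi> K n x"
      unfolding statistic_def mean_def using kl(3) finite_index_pairs by (intro Max_ge) force+
    finally have stat: "\<epsilon> / 2 \<le> statistic \<psi> K n x" .
    have obs: "norm (\<psi> (x (k, i))) \<le> R" if "k \<in> {1..K}" "i \<in> {1..n k}" for k i
    proof -
      have "x (k, i) \<in> space (Q (k, i))"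
        using x that by (auto simp: \<Omega> space_PiM PiE_iff I_def)
      then show ?thesis using R(2) space[OF that(1)] by (simp add: Q_def)
    qed
    have "p_perm \<psi> K n x \<le> K * exp (- (n_min K n * (\<epsilon> / 2)\<^sup>2) / (128 * R\<^sup>2))"
      using large by (intro p_perm_le[OF K pos R(1) obs stat]) auto
    also have "\<dots> \<le> \<alpha>" using level by (simp add: power_divide)
    finally show False using x by (simp add: perm_test_def)
  qed
  have "emeasure \<Omega> {x \<in> space \<Omega>. perm_test \<psi> K n \<alpha> x = 0} \<le> emeasure \<Omega> (A k \<union> A l)"
    using A kl by (intro emeasure_mono sub) auto
  also have "\<dots> \<le> emeasure \<Omega> (A k) + emeasure \<Omega> (A l)"
    using A kl by (intro emeasure_subadditive) auto
  also have "\<dots> \<le> ennreal (64 * R\<^sup>2 / (n_min K n * \<epsilon>\<^sup>2)) + ennreal (64 * R\<^sup>2 / (n_min K n * \<epsilon>\<^sup>2))"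
    using A kl by (intro add_mono) auto
  also have "\<dots> = ennreal (128 * R\<^sup>2 / (n_min K n * \<epsilon>\<^sup>2))"
    by (subst ennreal_plus[symmetric]) (auto simp: field_simps)
  finally show "emeasure (sample_law K n P) {x \<in> space (sample_law K n P). perm_test \<psi> K n \<alpha> x = 0}
      \<le> ennreal (128 * R\<^sup>2 / (n_min K n * \<epsilon>\<^sup>2))" unfolding \<Omega>_def .
qed

theorem theorem6p1:
  fixes M :: "'a measure"
    and val_at :: "'h::{real_inner,complete_space} \<Rightarrow> 'a \<Rightarrow> real"
    and h :: "'a \<Rightarrow> 'a \<Rightarrow> real"
    and \<psi> :: "'a \<Rightarrow> 'h"
    and K :: "nat \<Rightarrow> nat"
    and n :: "nat \<Rightarrow> nat \<Rightarrow> nat"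
    and b :: "nat \<Rightarrow> real"
    and \<alpha> :: real
  assumes rkhs: "reproducing_kernel (space M) val_at h"
    and feature: "feature_map (space M) h \<psi>"
    and h_measurable: "(\<lambda>(x, y). h x y) \<in> borel_measurable (M \<Otimes>\<^sub>M M)"
    and B1: "\<exists>B. \<forall>x\<in>space M. \<forall>y\<in>space M. 0 \<le> h x y \<and> h x y \<le> B"
    and K_ge_2: "\<And>t. K t \<ge> 2"
    and n_pos: "\<And>t k. k \<in> {1..K t} \<Longrightarrow> n t k \<ge> 1"
    and B2: "\<exists>c>0. \<forall>t. real (n_max (K t) (n t)) / real (n_min (K t) (n t)) \<le> c"
    and n_min_lim: "filterlim (\<lambda>t. n_min (K t) (n t)) at_top sequentially"
    and b_pos: "\<And>t. b t > 0"
    and b_lim: "filterlim b at_top sequentially"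
    and alpha: "0 < \<alpha>" "\<alpha> < 1"
  shows "limsup (\<lambda>t. worst_type_II_error M \<psi> (K t) (n t) \<alpha> (b t * r_star (K t) (n t))) = 0"
proof -
  obtain B where B: "\<And>x y. x \<in> space M \<Longrightarrow> y \<in> space M \<Longrightarrow> h x y \<le> B" using B1 by blast
  define R where "R = sqrt (max B 1)"
  have Rpos: "R > 0" by (simp add: R_def)
  have R: "norm (\<psi> x) \<le> R" if "x \<in> space M" for x
    unfolding R_def norm_eq_sqrt_inner
    using feature B[OF that that] that by (intro real_sqrt_le_mono) (auto simp: feature_map_def)
  define e where "e t = 128 * R\<^sup>2 / ((b t)\<^sup>2 * ln 2)" for t
  have bound: "worst_type_II_error M \<psi> (K t) (n t) \<alpha> (b t * r_star (K t) (n t)) \<le> ennreal (e t)"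
    if b1: "b t \<ge> 16 * R / sqrt (ln 2)" and b2: "(b t)\<^sup>2 \<ge> 512 * R\<^sup>2 * (1 - ln \<alpha> / ln 2)" for t
  proof -
    define m where "m = real (n_min (K t) (n t))"
    define L where "L = ln (real (K t))"
    define \<epsilon> where "\<epsilon> = b t * r_star (K t) (n t)"
    have "n_min (K t) (n t) \<in> n t ` {1..K t}"
      unfolding n_min_def using K_ge_2[of t] by (intro Min_in) auto
    then have pos: "n_min (K t) (n t) \<ge> 1" using n_pos[of _ t] by auto
    then have m: "m > 0" by (simp add: m_def)
    \<comment> \<open>a lower bound uniform in \<open>K t \<ge> 2\<close>\<close>
    have L: "ln 2 \<le> L" unfolding L_def using K_ge_2[of t] by simp
    then have L0: "L > 0" using ln_gt_zero[of "2::real"] by linarith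
    have \<epsilon>: "\<epsilon> = b t * sqrt (L / m)" by (simp add: \<epsilon>_def r_star_def L_def m_def)
    have m\<epsilon>: "m * \<epsilon>\<^sup>2 = (b t)\<^sup>2 * L"
      using m L0 by (simp add: \<epsilon> power_mult_distrib)
    have pos\<epsilon>: "\<epsilon> > 0" using b_pos[of t] m L0 by (simp add: \<epsilon>)
    have "16 * R \<le> b t * sqrt (ln 2)" using b1 by (simp add: field_simps)
    also have "\<dots> \<le> b t * sqrt L" using L b_pos[of t] by simp
    finally have large: "16 * R / sqrt m \<le> \<epsilon>"
      using m by (simp add: \<epsilon> real_sqrt_divide divide_right_mono)
    \<comment> \<open>with \<open>m * \<epsilon>\<^sup>2 = (b t)\<^sup>2 * L\<close>, the level condition reads \<open>L - (b t)\<^sup>2 * L / (512 * R\<^sup>2) \<le> ln \<alpha>\<close>\<close>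
    have "1 - ln \<alpha> / ln 2 \<le> (b t)\<^sup>2 / (512 * R\<^sup>2)"
      using b2 Rpos by (subst pos_le_divide_eq) (simp_all add: mult.commute)
    from mult_right_mono[OF this less_imp_le[OF L0]]
    have "L - (b t)\<^sup>2 * L / (512 * R\<^sup>2) \<le> L - (1 - ln \<alpha> / ln 2) * L"
      by (simp add: mult.commute)
    also have "\<dots> = ln \<alpha> * (L / ln 2)" by (simp add: field_simps)
    also have "\<dots> \<le> ln \<alpha> * 1"
      using L alpha by (intro mult_left_mono_neg) auto
    finally have "exp (L - (b t)\<^sup>2 * L / (512 * R\<^sup>2)) \<le> exp (ln \<alpha>)"
      unfolding mult_1_right exp_le_cancel_iff .
    then have "exp (L - (b t)\<^sup>2 * L / (512 * R\<^sup>2)) \<le> \<alpha>"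
      unfolding exp_ln[OF alpha(1)] .
    moreover have "exp (L - (b t)\<^sup>2 * L / (512 * R\<^sup>2)) = K t * exp (- (m * \<epsilon>\<^sup>2) / (512 * R\<^sup>2))"
    proof -
      have "K t = exp L" using K_ge_2[of t] by (simp add: L_def)
      then show ?thesis
        unfolding m\<epsilon> minus_divide_left[symmetric] by (simp only: exp_add[symmetric] diff_conv_add_uminus)
    qed
    ultimately have level: "K t * exp (- (m * \<epsilon>\<^sup>2) / (512 * R\<^sup>2)) \<le> \<alpha>" by simp
    have "worst_type_II_error M \<psi> (K t) (n t) \<alpha> \<epsilon> \<le> ennreal (128 * R\<^sup>2 / (m * \<epsilon>\<^sup>2))"
      unfolding m_def
      by (rule worst_type_II_error_le[OF feature h_measurable Rpos R K_ge_2 pos pos\<epsilon>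
            large[unfolded m_def] level[unfolded m_def]])
    also have "\<dots> \<le> ennreal (e t)"
      unfolding e_def m\<epsilon> using L L0 b_pos[of t]
      by (intro ennreal_leI divide_left_mono mult_left_mono) auto
    finally show ?thesis by (simp add: \<epsilon>_def)
  qed
  have b2_lim: "filterlim (\<lambda>t. (b t)\<^sup>2) at_top sequentially"
    using b_lim by (intro filterlim_pow_at_top) auto
  have "e \<longlonglongrightarrow> 0"
    unfolding e_def
    by (intro real_tendsto_divide_at_top[OF tendsto_const]
        filterlim_at_top_mult_tendsto_pos[OF tendsto_const] b2_lim) auto
  then have lim: "(\<lambda>t. ennreal (e t)) \<longlonglongrightarrow> 0"
    using tendsto_ennrealI by fastforce
  have upper: "\<forall>\<^sub>F t in sequentially.
      worst_type_II_error M \<psi> (K t) (n t) \<alpha> (b t * r_star (K t) (n t)) \<le> ennreal (e t)"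
    using filterlim_at_top[THEN iffD1, OF b_lim, rule_format, of "16 * R / sqrt (ln 2)"]
      filterlim_at_top[THEN iffD1, OF b2_lim, rule_format, of "512 * R\<^sup>2 * (1 - ln \<alpha> / ln 2)"]
    by eventually_elim (rule bound)
  have "(\<lambda>t. worst_type_II_error M \<psi> (K t) (n t) \<alpha> (b t * r_star (K t) (n t))) \<longlonglongrightarrow> 0"
    by (rule tendsto_sandwich[OF always_eventually upper tendsto_const lim]) simp
  then show ?thesis
    by (rule lim_imp_Limsup[rotated]) simp
qed

end
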